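(* Let $p \ge 1$. Let $\rho:\mathbb{R}^3\to\mathbb{R}_{\ge 0}$ be a probability density supported in the closed unit ball of $\mathbb{R}^3$, and let $I_1, I_2$ be its tomographic projections along the unit vectors $\mathbf{u}$ and $\mathbf{v}$ respectively. Denote by $\measuredangle(\mathbf{u},\mathbf{v})\in[0,\pi]$ the angle between $\mathbf{u}$ and $\mathbf{v}$. Then $$W_p^R(I_1,I_2)^p \le \big[2\sin(\measuredangle(\mathbf{u},\mathbf{v})/2)\big]^p \le \measuredangle(\mathbf{u},\mathbf{v})^p .$$
   Context: For $R\in\mathrm{SO}(3)$ define $(R\rho)(\mathbf{x})=\rho(R^T\mathbf{x})$. The tomographic projection of $\rho$ along a unit vector $\mathbf{u}$ is the function on $\mathbb{R}^2$ given by $I(x,y)=\int_{\mathbb{R}}(R\rho)(x,y,z)\,dz$, where $R\in\mathrm{SO}(3)$ is any rotation with $R\mathbf{u}=(0,0,-1)$; different choices of $R$ change $I$ only by an in-plane rotation. Such a projection is a probability density on $\mathbb{R}^2$ supported in the closed unit disk. For probability measures $\mu,\nu$ on $\mathbb{R}^2$, $W_p(\mu,\nu)=\big(\inf_{\pi\in\Pi(\mu,\nu)}\int\|a-b\|^p\,d\pi(a,b)\big)^{1/p}$, where $\Pi(\mu,\nu)$ is the set of couplings (joint distributions with marginals $\mu,\nu$). For $g\in\mathrm{SO}(2)$ and a density $I$ on $\mathbb{R}^2$ let $(gI)(\mathbf{w})=I(g^T\mathbf{w})$. The rotationally-invariant Wasserstein distance is $W_p^R(I_1,I_2)=\min_{g\in\mathrm{SO}(2)}W_p(I_1,gI_2)$.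 *)

theory Defs
  imports "HOL-Probability.Probability"
begin

text \<open>Rotation groups SO(3), SO(2) as real matrices.\<close>
definition SO :: "(real^'n^'n) set" where
  "SO = {R. orthogonal_matrix R \<and> det R = 1}"

text \<open>Rotated density: (R rho)(x) = rho(R^T x).\<close>
definition rot_density :: "real^'n^'n \<Rightarrow> (real^'n \<Rightarrow> real) \<Rightarrow> (real^'n \<Rightarrow> real)" where
  "rot_density R \<rho> = (\<lambda>x. \<rho> (transpose R *v x))"

text \<open>Tomographic projection computed with a given rotation R:
  I(x,y) = integral over z of (R rho)(x,y,z).\<close>
definition tomo_proj :: "real^3^3 \<Rightarrow> (real^3 \<Rightarrow> real) \<Rightarrow> (real^2 \<Rightarrow> real)" where
  "tomo_proj R \<rho> = (\<lambda>w. LINT z|lborel. rot_density R \<rho> (vector [w$1, w$2, z]))"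

text \<open>Probability measure on R^2 with a given density.\<close>
definition dens_measure :: "(real^2 \<Rightarrow> real) \<Rightarrow> (real^2) measure" where
  "dens_measure I = density lborel (\<lambda>w. ennreal (I w))"

text \<open>Couplings of two measures.\<close>
definition couplings :: "'a measure \<Rightarrow> 'b measure \<Rightarrow> ('a \<times> 'b) measure set" where
  "couplings \<mu> \<nu> = {\<pi>. sets \<pi> = sets (\<mu> \<Otimes>\<^sub>M \<nu>) \<and> prob_space \<pi> \<and>
      distr \<pi> \<mu> fst = \<mu> \<and> distr \<pi> \<nu> snd = \<nu>}"

text \<open>p-Wasserstein distance.\<close>
definition wasserstein :: "real \<Rightarrow> 'a::metric_space measure \<Rightarrow> 'a measure \<Rightarrow> real" where
  "wasserstein p \<mu> \<nu> =
     (enn2real (INF \<pi>\<in>couplings \<mu> \<nu>. \<integral>\<^sup>+ ab. ennreal (dist (fst ab) (snd ab) powr p) \<partial>\<pi>)) powr (1 / p)"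

text \<open>Rotationally invariant Wasserstein distance between densities on R^2.\<close>
definition wasserstein_rot :: "real \<Rightarrow> (real^2 \<Rightarrow> real) \<Rightarrow> (real^2 \<Rightarrow> real) \<Rightarrow> real" where
  "wasserstein_rot p I1 I2 =
     (INF g\<in>(SO :: (real^2^2) set). wasserstein p (dens_measure I1) (dens_measure (rot_density g I2)))"

text \<open>Angle between two nonzero vectors, in [0, pi].\<close>
definition vec_angle :: "real^'n \<Rightarrow> real^'n \<Rightarrow> real" where
  "vec_angle u v = arccos ((u \<bullet> v) / (norm u * norm v))"

end

theory Submission
  imports Defs
begin

text \<open>Both projections are push-forwards of the mass distribution \<open>\<rho>\<close> along linear maps: the
  projection taken with a rotation \<open>R\<close> is the law of the first two coordinates of \<open>R x\<close>.
  The product \<open>S = H\<^sub>u H\<^sub>s\<close> of the Householder reflections in \<open>u\<close> and \<open>s = u + v\<close> (or in any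
  \<open>s \<bottom> u\<close> if \<open>u = -v\<close>) is a rotation taking \<open>v\<close> to \<open>u\<close> and moving every point \<open>x\<close> by at
  most \<open>|u - v| |x|\<close>. The rotation \<open>R\<^sub>1 S R\<^sub>2\<^sup>T\<close> fixes the viewing axis, hence acts on the
  image plane as some \<open>g \<in> SO(2)\<close>, and \<open>g I\<^sub>2\<close> is the projection taken with \<open>R\<^sub>1 S\<close>.
  Coupling \<open>I\<^sub>1\<close> with \<open>g I\<^sub>2\<close> through \<open>x \<mapsto> (P R\<^sub>1 x, P R\<^sub>1 S x)\<close> moves no mass of the
  unit ball farther than \<open>|u - v| = 2 sin (\<angle>(u,v)/2)\<close>, and \<open>2 sin (\<theta>/2) \<le> \<theta>\<close>.\<close>

definition proj12 :: "real^3 \<Rightarrow> real^2" where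
  "proj12 x = vector [x$1, x$2]"

definition lift3 :: "real^2 \<Rightarrow> real \<Rightarrow> real^3" where
  "lift3 w z = vector [w$1, w$2, z]"

lemma proj12_lift3 [simp]: "proj12 (lift3 w z) = w"
  by (simp add: proj12_def lift3_def vec_eq_iff forall_2)

lemma dist_proj12_le: "dist (proj12 x) (proj12 y) \<le> dist x y"
  unfolding dist_norm norm_le by (simp add: proj12_def inner_vec_def sum_2 sum_3)

lemma tomo_proj_lift3: "tomo_proj R \<rho> w = (LINT z|lborel. \<rho> (transpose R *v lift3 w z))"
  by (simp add: tomo_proj_def rot_density_def lift3_def)

lemma borel_measurable_vec_componentwise:
  fixes f :: "'a \<Rightarrow> real^'n"
  assumes "\<And>i. (\<lambda>x. f x $ i) \<in> borel_measurable M"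
  shows "f \<in> borel_measurable M"
proof (subst borel_measurable_euclidean_space, intro ballI)
  fix b :: "real^'n" assume "b \<in> Basis"
  then obtain i where "b = axis i 1" by (auto simp: Basis_vec_def)
  then show "(\<lambda>x. f x \<bullet> b) \<in> borel_measurable M"
    using assms[of i] by (simp add: inner_axis)
qed

lemma borel_measurable_vec_nth [measurable (raw)]:
  "f \<in> borel_measurable M \<Longrightarrow> (\<lambda>x. f x $ i :: real) \<in> borel_measurable M"
  using measurable_compose[OF _ borel_measurable_nth] .

lemma borel_measurable_proj12 [measurable (raw)]:
  "f \<in> borel_measurable M \<Longrightarrow> (\<lambda>x. proj12 (f x)) \<in> borel_measurable M"
proof (rule borel_measurable_vec_componentwise)
  fix i :: 2
  show "f \<in> borel_measurable M \<Longrightarrow> (\<lambda>x. proj12 (f x) $ i) \<in> borel_measurable M"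
    using exhaust_2[of i] by (auto simp: proj12_def)
qed

lemma borel_measurable_lift3 [measurable (raw)]:
  "f \<in> borel_measurable M \<Longrightarrow> g \<in> borel_measurable M \<Longrightarrow> (\<lambda>x. lift3 (f x) (g x)) \<in> borel_measurable M"
proof (rule borel_measurable_vec_componentwise)
  fix i :: 3
  show "f \<in> borel_measurable M \<Longrightarrow> g \<in> borel_measurable M \<Longrightarrow>
      (\<lambda>x. lift3 (f x) (g x) $ i) \<in> borel_measurable M"
    using exhaust_3[of i] by (auto simp: lift3_def)
qed

lemma borel_measurable_matrix_vector_mult [measurable (raw)]:
  fixes A :: "real^'n^'m"
  shows "f \<in> borel_measurable M \<Longrightarrow> (\<lambda>x. A *v f x) \<in> borel_measurable M"
  by (rule borel_measurable_vec_componentwise) (auto intro!: borel_measurable_sum simp: matrix_vector_mult_def)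

lemma lborel_distr_orthogonal_matrix:
  fixes A :: "real^('n::{finite,wellorder})^('n::{finite,wellorder})"
  assumes A: "orthogonal_matrix A"
  shows "distr lborel borel ((*v) A) = lborel"
proof (rule lborel_eqI[symmetric])
  let ?T = "(*v) (transpose A)"
  have inv: "A *v (?T x) = x" "?T (A *v x) = x" for x
    using A by (simp_all add: orthogonal_matrix_def matrix_vector_mul_assoc del: transpose_matrix_vector)
  have orth: "orthogonal_transformation ?T"
    using A by (simp add: orthogonal_transformation_matrix matrix_of_matrix_vector_mul del: transpose_matrix_vector)
  fix l u :: "real^('n::{finite,wellorder})"
  assume "\<And>b. b \<in> Basis \<Longrightarrow> l \<bullet> b \<le> u \<bullet> b"
  then have box: "emeasure lborel (box l u) = (\<Prod>b\<in>Basis. (u - l) \<bullet> b)" by simp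
  have pre: "(*v) A -` box l u = ?T ` box l u"
    using inv by (auto simp del: transpose_matrix_vector) (metis image_eqI)
  have "(\<lambda>x. A *v x) \<in> borel_measurable borel" by measurable
  then have "(*v) A -` box l u \<in> sets borel" by (rule measurable_sets_borel) simp
  then have borel: "?T ` box l u \<in> sets borel" by (simp only: pre)
  have bounded: "bounded (?T ` box l u)"
    using orthogonal_transformation_linear[OF orth]
    by (intro bounded_linear_image bounded_box linear_conv_bounded_linear[THEN iffD1])
  have "emeasure (distr lborel borel ((*v) A)) (box l u) = emeasure lborel (?T ` box l u)"
    by (simp add: emeasure_distr pre)
  also have "\<dots> = measure lebesgue (?T ` box l u)"
    using emeasure_bounded_finite[OF bounded] borel by (simp add: emeasure_eq_ennreal_measure)
  also have "\<dots> = measure lebesgue (box l u)"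
    using measure_orthogonal_image[OF orth, of "box l u"] by simp
  also have "\<dots> = emeasure lborel (box l u)"
    using emeasure_lborel_box_finite[of l u] by (simp add: emeasure_eq_ennreal_measure)
  finally show "emeasure (distr lborel borel ((*v) A)) (box l u) = (\<Prod>b\<in>Basis. (u - l) \<bullet> b)"
    using box by simp
qed simp

lemma distr_density_lborel_orthogonal_matrix:
  fixes A :: "real^('n::{finite,wellorder})^('n::{finite,wellorder})"
  assumes A: "orthogonal_matrix A" and [measurable]: "f \<in> borel_measurable borel"
  shows "distr (density lborel f) borel ((*v) A) = density lborel (\<lambda>y. f (transpose A *v y))"
proof -
  have inv: "transpose A *v (A *v x) = x" for x
    using A by (simp add: orthogonal_matrix_def matrix_vector_mul_assoc del: transpose_matrix_vector)
  have "density lborel (\<lambda>y. f (transpose A *v y))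
      = density (distr lborel borel ((*v) A)) (\<lambda>y. f (transpose A *v y))"
    by (simp only: lborel_distr_orthogonal_matrix[OF A])
  also have "\<dots> = distr (density lborel (\<lambda>x. f (transpose A *v (A *v x)))) borel ((*v) A)"
    by (rule density_distr) measurable
  finally show ?thesis
    by (simp only: inv)
qed

lemma prod_Basis_vec: "(\<Prod>b\<in>Basis. x \<bullet> b) = (\<Prod>i\<in>UNIV. x $ i)"
  for x :: "real^'n"
proof -
  have "inj (\<lambda>i::'n. axis i (1::real))"
    by (auto intro!: injI simp: axis_eq_axis)
  then show ?thesis
    by (simp add: Basis_vec_def UNION_singleton_eq_range prod.reindex inner_axis)
qed

lemma lborel_distr_lift3: "distr (lborel \<Otimes>\<^sub>M lborel) borel (\<lambda>(w, z). lift3 w z) = lborel"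
proof (rule lborel_eqI[symmetric])
  fix l u :: "real^3"
  assume le_Basis: "\<And>b. b \<in> Basis \<Longrightarrow> l \<bullet> b \<le> u \<bullet> b"
  have le: "l $ i \<le> u $ i" for i
    using le_Basis[of "axis i 1"] by (auto simp: Basis_vec_def inner_axis)
  let ?l = "proj12 l" and ?u = "proj12 u"
  have le2: "?l \<bullet> b \<le> ?u \<bullet> b" if "b \<in> Basis" for b
  proof -
    obtain i :: 2 where "b = axis i 1" using \<open>b \<in> Basis\<close> by (auto simp: Basis_vec_def)
    then show ?thesis using le exhaust_2[of i] by (auto simp: inner_axis proj12_def)
  qed
  have pre: "(\<lambda>(w, z). lift3 w z) -` box l u \<inter> space (lborel \<Otimes>\<^sub>M lborel) = box ?l ?u \<times> {l$3<..<u$3}"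
    by (auto simp: mem_box_cart forall_2 forall_3 space_pair_measure lift3_def proj12_def)
  have prod3: "(\<Prod>i\<in>UNIV. f i) = f 1 * f 2 * (f 3 :: real)" for f :: "3 \<Rightarrow> real"
    unfolding UNIV_3 by (simp add: ac_simps)
  have "emeasure (distr (lborel \<Otimes>\<^sub>M lborel) borel (\<lambda>(w, z). lift3 w z)) (box l u)
      = emeasure (lborel \<Otimes>\<^sub>M lborel) (box ?l ?u \<times> {l$3<..<u$3})"
    by (subst emeasure_distr) (simp_all add: pre flip: lborel_prod)
  also have "\<dots> = emeasure lborel (box ?l ?u) * emeasure lborel {l$3<..<u$3}"
    by (rule lborel.emeasure_pair_measure_Times) simp_all
  also have "\<dots> = ennreal ((u$1 - l$1) * (u$2 - l$2)) * ennreal (u$3 - l$3)"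
    using le2 le[of 3] by (simp add: emeasure_lborel_box prod_Basis_vec UNIV_2 proj12_def)
  also have "\<dots> = ennreal ((u$1 - l$1) * (u$2 - l$2) * (u$3 - l$3))"
    using le[of 1] le[of 2] le[of 3] by (simp add: ennreal_mult)
  also have "(u$1 - l$1) * (u$2 - l$2) * (u$3 - l$3) = (\<Prod>b\<in>Basis. (u - l) \<bullet> b)"
    using prod3[of "\<lambda>i. (u - l) $ i"] by (simp add: prod_Basis_vec)
  finally show "emeasure (distr (lborel \<Otimes>\<^sub>M lborel) borel (\<lambda>(w, z). lift3 w z)) (box l u)
      = ennreal (\<Prod>b\<in>Basis. (u - l) \<bullet> b)" .
qed simp

lemma (in sigma_finite_measure) distr_fst_density_pair:
  assumes [measurable]: "f \<in> borel_measurable (N \<Otimes>\<^sub>M M)"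
  shows "distr (density (N \<Otimes>\<^sub>M M) f) N fst = density N (\<lambda>x. \<integral>\<^sup>+y. f (x, y) \<partial>M)"
proof (rule measure_eqI)
  fix A assume "A \<in> sets (distr (density (N \<Otimes>\<^sub>M M) f) N fst)"
  then have [measurable]: "A \<in> sets N" by simp
  have "emeasure (distr (density (N \<Otimes>\<^sub>M M) f) N fst) A
      = (\<integral>\<^sup>+p. f p * indicator (A \<times> space M) p \<partial>(N \<Otimes>\<^sub>M M))"
    by (simp add: emeasure_distr emeasure_density space_pair_measure vimage_fst Times_Int_Times)
  also have "\<dots> = (\<integral>\<^sup>+x. \<integral>\<^sup>+y. f (x, y) * indicator A x \<partial>M \<partial>N)"
    by (subst nn_integral_fst[symmetric]) (auto intro!: nn_integral_cong split: split_indicator)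
  also have "\<dots> = (\<integral>\<^sup>+x. (\<integral>\<^sup>+y. f (x, y) \<partial>M) * indicator A x \<partial>N)"
    by (intro nn_integral_cong nn_integral_multc) measurable
  also have "\<dots> = emeasure (density N (\<lambda>x. \<integral>\<^sup>+y. f (x, y) \<partial>M)) A"
    by (simp add: emeasure_density)
  finally show "emeasure (distr (density (N \<Otimes>\<^sub>M M) f) N fst) A
      = emeasure (density N (\<lambda>x. \<integral>\<^sup>+y. f (x, y) \<partial>M)) A" .
qed simp

lemma distr_density_proj12:
  fixes f :: "real^3 \<Rightarrow> ennreal"
  assumes [measurable]: "f \<in> borel_measurable borel"
  shows "distr (density lborel f) borel proj12 = density lborel (\<lambda>w. \<integral>\<^sup>+z. f (lift3 w z) \<partial>lborel)"
proof -
  have "(\<lambda>(w, z). lift3 w z) \<in> borel_measurable (borel \<Otimes>\<^sub>M borel)"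
    unfolding case_prod_beta' by measurable
  then have [measurable]: "(\<lambda>(w, z). lift3 w z) \<in> borel_measurable (lborel \<Otimes>\<^sub>M lborel)"
    by (simp add: borel_prod lborel_prod)
  have "density lborel f
      = distr (density (lborel \<Otimes>\<^sub>M lborel) (\<lambda>(w, z). f (lift3 w z))) borel (\<lambda>(w, z). lift3 w z)"
    by (subst (1) lborel_distr_lift3[symmetric], subst density_distr) (simp_all add: case_prod_beta')
  then have "distr (density lborel f) borel proj12
      = distr (density (lborel \<Otimes>\<^sub>M lborel) (\<lambda>(w, z). f (lift3 w z))) lborel fst"
    by (simp add: distr_distr comp_def case_prod_beta' cong: distr_cong)
  also have "\<dots> = density lborel (\<lambda>w. \<integral>\<^sup>+z. f (lift3 w z) \<partial>lborel)"
    by (subst lborel.distr_fst_density_pair) simp_all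
  finally show ?thesis .
qed

lemma distr_density_proj12_real:
  fixes \<sigma> :: "real^3 \<Rightarrow> real"
  assumes [measurable]: "\<sigma> \<in> borel_measurable borel" and nonneg: "\<And>x. 0 \<le> \<sigma> x"
    and finite: "(\<integral>\<^sup>+x. \<sigma> x \<partial>lborel) \<noteq> \<infinity>"
  shows "distr (density lborel \<sigma>) borel proj12 = density lborel (\<lambda>w. LINT z|lborel. \<sigma> (lift3 w z))"
proof -
  let ?F = "\<lambda>w. \<integral>\<^sup>+z. ennreal (\<sigma> (lift3 w z)) \<partial>lborel"
  have marginal: "distr (density lborel \<sigma>) borel proj12 = density lborel ?F"
    by (rule distr_density_proj12) simp
  have "(\<integral>\<^sup>+w. ?F w \<partial>lborel) = emeasure (density lborel ?F) (space lborel)"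
    by (simp add: emeasure_density)
  also have "\<dots> = emeasure (density lborel \<sigma>) (space lborel)"
    by (simp flip: marginal add: emeasure_distr)
  also have "\<dots> = (\<integral>\<^sup>+x. \<sigma> x \<partial>lborel)"
    by (simp add: emeasure_density)
  \<comment> \<open>On slices where \<open>\<sigma>\<close> is not integrable the Bochner integral is 0; there are only
    null-many of them because the total mass is finite.\<close>
  finally have "AE w in lborel. ?F w \<noteq> \<infinity>"
    using finite by (intro nn_integral_PInf_AE) simp_all
  then have "AE w in lborel. ?F w = ennreal (LINT z|lborel. \<sigma> (lift3 w z))"
  proof eventually_elim
    case (elim w)
    then show ?case
      using nonneg by (intro nn_integral_eq_integral integrableI_nonneg) (simp_all add: less_top)
  qed
  then show ?thesis
    unfolding marginal by (intro density_cong) simp_all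
qed

lemma dens_measure_tomo_proj:
  fixes A :: "real^3^3" and \<rho> :: "real^3 \<Rightarrow> real"
  assumes A: "orthogonal_matrix A" and [measurable]: "\<rho> \<in> borel_measurable borel"
    and nonneg: "\<And>x. 0 \<le> \<rho> x" and finite: "(\<integral>\<^sup>+x. \<rho> x \<partial>lborel) \<noteq> \<infinity>"
  shows "dens_measure (tomo_proj A \<rho>) = distr (density lborel \<rho>) borel (\<lambda>x. proj12 (A *v x))"
proof -
  have [measurable]: "rot_density A \<rho> \<in> borel_measurable borel"
    unfolding rot_density_def by measurable
  have rot: "distr (density lborel \<rho>) borel ((*v) A) = density lborel (rot_density A \<rho>)"
    using distr_density_lborel_orthogonal_matrix[OF A, of "\<lambda>x. ennreal (\<rho> x)"]
    by (simp add: rot_density_def)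
  have "(\<integral>\<^sup>+x. rot_density A \<rho> x \<partial>lborel) = emeasure (density lborel (rot_density A \<rho>)) (space lborel)"
    by (simp add: emeasure_density)
  also have "\<dots> = (\<integral>\<^sup>+x. \<rho> x \<partial>lborel)"
    by (simp flip: rot add: emeasure_distr emeasure_density)
  finally have finite_rot: "(\<integral>\<^sup>+x. rot_density A \<rho> x \<partial>lborel) \<noteq> \<infinity>"
    using finite by simp
  have "distr (density lborel \<rho>) borel (\<lambda>x. proj12 (A *v x))
      = distr (density lborel (rot_density A \<rho>)) borel proj12"
    by (simp flip: rot add: distr_distr comp_def)
  also have "\<dots> = density lborel (\<lambda>w. LINT z|lborel. rot_density A \<rho> (lift3 w z))"
    using nonneg finite_rot by (intro distr_density_proj12_real) (simp_all add: rot_density_def del: transpose_matrix_vector)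
  also have "\<dots> = dens_measure (tomo_proj A \<rho>)"
    by (simp add: dens_measure_def tomo_proj_def lift3_def)
  finally show ?thesis ..
qed

lemma wasserstein_distr_le:
  fixes f g :: "'b \<Rightarrow> 'a::{metric_space, second_countable_topology}"
  assumes "prob_space M" and [measurable]: "f \<in> borel_measurable M" "g \<in> borel_measurable M"
    and close: "AE x in M. dist (f x) (g x) \<le> c" and p: "p > 0" and c: "c \<ge> 0"
  shows "wasserstein p (distr M borel f) (distr M borel g) \<le> c"
proof -
  interpret prob_space M by fact
  let ?\<mu> = "distr M borel f" and ?\<nu> = "distr M borel g"
  let ?cost = "\<lambda>ab. ennreal (dist (fst ab) (snd ab) powr p)"
  define \<pi> where "\<pi> = distr M (?\<mu> \<Otimes>\<^sub>M ?\<nu>) (\<lambda>x. (f x, g x))"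
  have [measurable]: "(\<lambda>x. (f x, g x)) \<in> measurable M (?\<mu> \<Otimes>\<^sub>M ?\<nu>)"
    by measurable
  have "\<pi> \<in> couplings ?\<mu> ?\<nu>"
    unfolding couplings_def
  proof (intro CollectI conjI)
    show "sets \<pi> = sets (?\<mu> \<Otimes>\<^sub>M ?\<nu>)" "prob_space \<pi>"
      unfolding \<pi>_def by (simp_all add: prob_space_distr)
    show "distr \<pi> ?\<mu> fst = ?\<mu>" "distr \<pi> ?\<nu> snd = ?\<nu>"
      unfolding \<pi>_def by (simp_all add: distr_distr comp_def cong: distr_cong)
  qed
  moreover have "(\<integral>\<^sup>+ab. ?cost ab \<partial>\<pi>) \<le> ennreal (c powr p)"
  proof -
    have "(\<integral>\<^sup>+ab. ?cost ab \<partial>\<pi>) = (\<integral>\<^sup>+x. ennreal (dist (f x) (g x) powr p) \<partial>M)"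
      unfolding \<pi>_def by (subst nn_integral_distr) simp_all
    also have "\<dots> \<le> (\<integral>\<^sup>+x. ennreal (c powr p) \<partial>M)"
      using close by (intro nn_integral_mono_AE) (auto elim!: eventually_mono intro!: ennreal_leI powr_mono2 less_imp_le[OF p])
    also have "\<dots> = ennreal (c powr p)"
      by (simp add: emeasure_space_1)
    finally show ?thesis .
  qed
  ultimately have "(INF \<pi>\<in>couplings ?\<mu> ?\<nu>. \<integral>\<^sup>+ab. ?cost ab \<partial>\<pi>) \<le> ennreal (c powr p)"
    by (meson INF_lower order_trans)
  then have "enn2real (INF \<pi>\<in>couplings ?\<mu> ?\<nu>. \<integral>\<^sup>+ab. ?cost ab \<partial>\<pi>) \<le> c powr p"
    using enn2real_mono by fastforce
  then have "wasserstein p ?\<mu> ?\<nu> \<le> (c powr p) powr (1 / p)"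
    unfolding wasserstein_def using p by (intro powr_mono2) simp_all
  also have "\<dots> = c"
    using p c by (simp add: powr_powr)
  finally show ?thesis .
qed

lemma norm_orthogonal_matrix_mult:
  fixes Q :: "real^'n^'n"
  assumes "orthogonal_matrix Q"
  shows "norm (Q *v x) = norm x"
  using assms orthogonal_transformation_matrix[of "(*v) Q"] orthogonal_transformation_norm
  by (simp add: matrix_of_matrix_vector_mul)

lemma Gram_unit_pair_le:
  fixes u v x :: "'a::real_inner"
  assumes u: "norm u = 1" and v: "norm v = 1"
  shows "(u \<bullet> x)\<^sup>2 + (v \<bullet> x)\<^sup>2 - 2 * (u \<bullet> v) * (u \<bullet> x) * (v \<bullet> x)
    \<le> (1 - (u \<bullet> v)\<^sup>2) * (x \<bullet> x)"
proof -
  have uu: "u \<bullet> u = 1" using u by (simp add: dot_square_norm)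
  have vv: "v \<bullet> v = 1" using v by (simp add: dot_square_norm)
  define k where "k = u \<bullet> v"
  define y where "y = v - k *\<^sub>R u"
  define x' where "x' = x - (u \<bullet> x) *\<^sub>R u"
  have yx': "y \<bullet> x' = v \<bullet> x - k * (u \<bullet> x)"
    by (simp add: y_def x'_def k_def inner_diff_left inner_diff_right uu inner_commute)
  have yy: "y \<bullet> y = 1 - k^2"
    by (simp add: y_def k_def inner_diff_left inner_diff_right uu vv inner_commute[of v u] power2_eq_square)
  have x'x': "x' \<bullet> x' = x \<bullet> x - (u \<bullet> x)\<^sup>2"
    by (simp add: x'_def inner_diff_left inner_diff_right uu inner_commute[of x u] power2_eq_square)
  have "(y \<bullet> x')\<^sup>2 \<le> (y \<bullet> y) * (x' \<bullet> x')"
    using Cauchy_Schwarz_ineq by blast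
  then show ?thesis
    unfolding yx' yy x'x' k_def[symmetric] by (simp add: power2_eq_square algebra_simps)
qed

definition householder :: "real^'n \<Rightarrow> real^'n^'n" where
  "householder s = (\<chi> i j. (if i = j then 1 else 0) - 2 / (s \<bullet> s) * s$i * s$j)"

lemma householder_apply: "householder s *v x = x - (2 * (s \<bullet> x) / (s \<bullet> s)) *\<^sub>R s"
  by (simp add: householder_def vec_eq_iff matrix_vector_mult_def inner_vec_def left_diff_distrib
      sum_subtractf sum_distrib_left sum_divide_distrib algebra_simps if_distrib[of "(*) _"] cong: if_cong)

lemma householder_neg_self: "s \<noteq> 0 \<Longrightarrow> householder s *v (- s) = s"
  by (simp add: householder_apply scaleR_2)

lemma householder_orthogonal: "s \<bullet> x = 0 \<Longrightarrow> householder s *v x = x"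
  by (simp add: householder_apply)

lemma transpose_householder: "transpose (householder s) = householder s"
  by (simp add: householder_def transpose_def vec_eq_iff mult.commute)

lemma householder_involutive:
  assumes "s \<noteq> 0"
  shows "householder s ** householder s = mat 1"
proof -
  have "householder s *v (householder s *v x) = x" for x
    using assms by (simp add: householder_apply inner_diff_right field_simps)
  then show ?thesis
    by (simp add: matrix_eq matrix_vector_mul_assoc)
qed

lemma orthogonal_matrix_householder: "s \<noteq> 0 \<Longrightarrow> orthogonal_matrix (householder s)"
  by (simp add: orthogonal_matrix_def transpose_householder householder_involutive)

lemma det_householder:
  fixes s :: "real^3"
  assumes "s \<noteq> 0"
  shows "det (householder s) = -1"
proof -
  have rank_one: "det (\<chi> i j. (if i = j then 1 else 0) - c * s$i * s$j) = 1 - c * (s \<bullet> s)" for c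
    by (simp add: det_3 inner_vec_def sum_3 algebra_simps)
  have "s \<bullet> s \<noteq> 0" using assms by simp
  then show ?thesis
    unfolding householder_def rank_one by simp
qed

lemma householder_pair_maps:
  fixes u v :: "real^'n"
  assumes u: "norm u = 1" and v: "norm v = 1" and uv: "u + v \<noteq> 0"
  shows "householder u *v (householder (u + v) *v v) = u"
proof -
  have uu: "u \<bullet> u = 1" and vv: "v \<bullet> v = 1"
    using u v by (simp_all add: dot_square_norm)
  have "(u + v) \<bullet> (u + v) = 2 * ((u + v) \<bullet> v)"
    by (simp add: inner_add_left inner_add_right inner_commute uu vv)
  moreover have "(u + v) \<bullet> (u + v) \<noteq> 0"
    using uv by simp
  ultimately have "householder (u + v) *v v = - u"
    by (simp add: householder_apply)
  then show ?thesis
    by (simp add: householder_apply uu scaleR_2)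
qed

lemma householder_pair_displacement:
  fixes u v x :: "real^'n"
  assumes u: "norm u = 1" and v: "norm v = 1" and uv: "u + v \<noteq> 0"
  shows "norm (x - householder u *v (householder (u + v) *v x)) \<le> norm (u - v) * norm x"
proof -
  define s where "s = u + v"
  define k where "k = u \<bullet> v"
  define \<alpha> where "\<alpha> = u \<bullet> x"
  define \<beta> where "\<beta> = v \<bullet> x"
  define t where "t = 2 * (s \<bullet> x) / (s \<bullet> s)"
  have uu: "u \<bullet> u = 1" and vv: "v \<bullet> v = 1"
    using u v by (simp_all add: dot_square_norm)
  have ss: "s \<bullet> s = 2 * (1 + k)" and su: "s \<bullet> u = 1 + k"
    by (simp_all add: s_def k_def inner_add_left inner_add_right uu vv inner_commute algebra_simps)
  have "s \<bullet> s \<noteq> 0" using uv by (simp add: s_def)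
  then have "1 + k \<noteq> 0" using ss by simp
  moreover have "s \<bullet> x = \<alpha> + \<beta>"
    by (simp add: s_def \<alpha>_def \<beta>_def inner_add_left)
  ultimately have t: "t * (1 + k) = \<alpha> + \<beta>"
    by (simp add: t_def ss field_simps)
  have "u \<bullet> (x - t *\<^sub>R s) = - \<beta>"
    using t by (simp add: inner_diff_right inner_commute[of u s] su \<alpha>_def[symmetric] algebra_simps)
  then have diff: "x - householder u *v (householder s *v x) = t *\<^sub>R s - (2 * \<beta>) *\<^sub>R u"
    by (simp add: householder_apply t_def[symmetric] uu)
  have "(norm (x - householder u *v (householder s *v x)))^2
      = t^2 * (2 * (1 + k)) - 4 * t * \<beta> * (1 + k) + 4 * \<beta>^2"
    unfolding diff power2_norm_eq_inner
    by (simp add: inner_diff_left inner_diff_right uu ss su inner_commute power2_eq_square algebra_simps)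
  then have "(1 + k) * (norm (x - householder u *v (householder s *v x)))^2
      = 2 * (t * (1 + k))^2 - 4 * \<beta> * (t * (1 + k)) * (1 + k) + 4 * \<beta>^2 * (1 + k)"
    by (simp only:) (simp add: power2_eq_square algebra_simps)
  also have "\<dots> = 2 * (\<alpha>^2 + \<beta>^2 - 2 * k * \<alpha> * \<beta>)"
    unfolding t by (simp add: power2_eq_square algebra_simps)
  also have "\<dots> \<le> 2 * ((1 - k^2) * (x \<bullet> x))"
    using Gram_unit_pair_le[OF u v, of x] by (simp add: \<alpha>_def \<beta>_def k_def)
  also have "\<dots> = (1 + k) * (norm (u - v) * norm x)^2"
  proof -
    have uv2: "(norm (u - v))^2 = 2 - 2 * k"
      unfolding power2_norm_eq_inner by (simp add: inner_diff_left inner_diff_right uu vv k_def inner_commute)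
    show ?thesis
      unfolding power_mult_distrib uv2 power2_norm_eq_inner[of x] by (simp add: power2_eq_square algebra_simps)
  qed
  finally have "(1 + k) * (norm (x - householder u *v (householder s *v x)))^2 \<le> (1 + k) * (norm (u - v) * norm x)^2" .
  moreover have "1 + k > 0"
    using \<open>1 + k \<noteq> 0\<close> Cauchy_Schwarz_ineq2[of u v] u v by (simp add: k_def)
  ultimately show ?thesis
    unfolding s_def by (simp add: power2_le_iff_abs_le)
qed

lemma rotation_onto_unit_vector:
  fixes u v :: "real^3"
  assumes u: "norm u = 1" and v: "norm v = 1"
  obtains S where "S \<in> SO" "S *v v = u" "\<And>x. norm (x - S *v x) \<le> norm (u - v) * norm x"
proof (cases "u + v = 0")
  case True
  then have vu: "v = - u" by (simp add: add_eq_0_iff)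
  obtain a :: "real^3" where a: "a \<noteq> 0" "orthogonal u a"
    using orthogonal_to_vector_exists[of u] by auto
  have u0: "u \<noteq> 0" using u by auto
  define S where "S = householder u ** householder a"
  show thesis
  proof (rule that[of S])
    show "S \<in> SO"
      using a u0 by (simp add: S_def SO_def orthogonal_matrix_mul orthogonal_matrix_householder det_mul det_householder)
    show "S *v v = u"
      using a u0 by (simp add: S_def vu orthogonal_def inner_commute householder_orthogonal householder_neg_self
          flip: matrix_vector_mul_assoc)
    fix x
    have "norm (x - S *v x) \<le> norm x + norm (S *v x)"
      by (rule norm_triangle_ineq4)
    also have "\<dots> = 2 * norm x"
      using \<open>S \<in> SO\<close> by (simp add: SO_def norm_orthogonal_matrix_mult)
    also have "2 = norm (u - v)"
      using u by (simp add: vu flip: scaleR_2)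
    finally show "norm (x - S *v x) \<le> norm (u - v) * norm x" .
  qed
next
  case False
  have "u \<noteq> 0" using u by auto
  show thesis
  proof (rule that[of "householder u ** householder (u + v)"])
    show "householder u ** householder (u + v) \<in> SO"
      using False \<open>u \<noteq> 0\<close>
      by (simp add: SO_def orthogonal_matrix_mul orthogonal_matrix_householder det_mul det_householder)
    show "(householder u ** householder (u + v)) *v v = u"
      using householder_pair_maps[OF u v False] by (simp flip: matrix_vector_mul_assoc)
    show "norm (x - (householder u ** householder (u + v)) *v x) \<le> norm (u - v) * norm x" for x
      using householder_pair_displacement[OF u v False] by (simp flip: matrix_vector_mul_assoc)
  qed
qed

lemma
  fixes u v :: "real^'n"
  assumes u: "norm u = 1" and v: "norm v = 1"
  shows cos_vec_angle_unit: "cos (vec_angle u v) = u \<bullet> v"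
    and vec_angle_unit_bounds: "0 \<le> vec_angle u v" "vec_angle u v \<le> pi"
proof -
  have "-1 \<le> u \<bullet> v" "u \<bullet> v \<le> 1"
    using Cauchy_Schwarz_ineq2[of u v] u v by auto
  then show "cos (vec_angle u v) = u \<bullet> v" "0 \<le> vec_angle u v" "vec_angle u v \<le> pi"
    using u v by (simp_all add: vec_angle_def arccos_lbound arccos_ubound)
qed

lemma norm_diff_eq_chord:
  fixes u v :: "real^'n"
  assumes u: "norm u = 1" and v: "norm v = 1"
  shows "norm (u - v) = 2 * sin (vec_angle u v / 2)"
proof -
  define \<theta> where "\<theta> = vec_angle u v"
  have "0 \<le> sin (\<theta> / 2)"
    using vec_angle_unit_bounds[OF u v] by (simp add: \<theta>_def sin_ge_zero)
  have "(norm (u - v))^2 = 2 - 2 * (u \<bullet> v)"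
  proof -
    have "u \<bullet> u = 1" "v \<bullet> v = 1"
      using u v by (simp_all add: dot_square_norm)
    then show ?thesis
      unfolding power2_norm_eq_inner by (simp add: inner_diff_left inner_diff_right inner_commute)
  qed
  also have "\<dots> = (2 * sin (\<theta> / 2))^2"
    using cos_double_sin[of "\<theta> / 2"] cos_vec_angle_unit[OF u v] by (simp add: \<theta>_def power_mult_distrib)
  finally show ?thesis
    using \<open>0 \<le> sin (\<theta> / 2)\<close> by (subst (asm) power2_eq_iff_nonneg) (simp_all add: \<theta>_def)
qed

definition block12 :: "real^3^3 \<Rightarrow> real^2^2" where
  "block12 G = (\<chi> i j. G $ (if i = 1 then 1 else 2) $ (if j = 1 then 1 else 2))"

lemma rotation_fixing_axis3:
  fixes G :: "real^3^3"
  assumes G: "G \<in> SO" and fixes_axis: "G *v axis 3 1 = axis 3 1"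
  shows "block12 G \<in> SO" and "transpose G *v lift3 w z = lift3 (transpose (block12 G) *v w) z"
proof -
  have GTG: "transpose G ** G = mat 1" and det: "det G = 1"
    using G by (simp_all add: SO_def orthogonal_matrix)
  have "transpose G *v axis 3 1 = axis 3 1"
    using fixes_axis GTG by (metis matrix_vector_mul_assoc matrix_vector_mul_lid)
  then have row3: "G $ 3 $ j = (if j = 3 then 1 else 0)" for j
    unfolding matrix_vector_mult_basis by (simp add: column_def vec_eq_iff axis_def transpose_def)
  have col3: "G $ i $ 3 = (if i = 3 then 1 else 0)" for i
    using fixes_axis unfolding matrix_vector_mult_basis by (simp add: column_def vec_eq_iff axis_def)
  have entries: "(transpose G ** G) $ i $ j = (mat 1 :: real^3^3) $ i $ j" for i j
    using GTG by simp
  have "transpose (block12 G) ** block12 G = mat 1"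
    using entries[of 1 1] entries[of 1 2] entries[of 2 1] entries[of 2 2] row3
    by (simp add: block12_def vec_eq_iff forall_2 matrix_matrix_mult_def transpose_def sum_2 sum_3 mat_def)
  moreover have "det (block12 G) = 1"
    using det row3 col3 by (simp add: block12_def det_2 det_3)
  ultimately show "block12 G \<in> SO"
    by (simp add: SO_def orthogonal_matrix)
  show "transpose G *v lift3 w z = lift3 (transpose (block12 G) *v w) z"
    using row3 col3
    by (simp add: block12_def lift3_def vec_eq_iff forall_3 matrix_vector_mult_def transpose_def sum_2 sum_3)
qed

lemma rot_density_tomo_proj:
  assumes "\<And>w z. transpose G *v lift3 w z = lift3 (transpose g *v w) z"
  shows "rot_density g (tomo_proj R \<rho>) = tomo_proj (G ** R) \<rho>"
proof
  fix w
  have "tomo_proj (G ** R) \<rho> w = (LINT z|lborel. \<rho> (transpose R *v (transpose G *v lift3 w z)))"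
    by (simp add: tomo_proj_lift3 matrix_transpose_mul matrix_vector_mul_assoc del: transpose_matrix_vector)
  also have "\<dots> = rot_density g (tomo_proj R \<rho>) w"
    by (simp add: assms tomo_proj_lift3 rot_density_def del: transpose_matrix_vector)
  finally show "rot_density g (tomo_proj R \<rho>) w = tomo_proj (G ** R) \<rho> w" ..
qed

lemma tomo_proj_in_plane_rotation:
  fixes R1 R2 S :: "real^3^3" and u v :: "real^3"
  assumes "R1 \<in> SO" "R2 \<in> SO" "S \<in> SO"
    and u: "R1 *v u = vector [0, 0, -1]" and v: "R2 *v v = vector [0, 0, -1]" and "S *v v = u"
  obtains g where "g \<in> SO" "rot_density g (tomo_proj R2 \<rho>) = tomo_proj (R1 ** S) \<rho>"
proof -
  have R2: "R2 ** transpose R2 = mat 1" "transpose R2 ** R2 = mat 1"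
    using \<open>R2 \<in> SO\<close> by (simp_all add: SO_def orthogonal_matrix_def)
  define G where "G = R1 ** S ** transpose R2"
  have "G \<in> SO"
    using assms(1-3) by (simp add: G_def SO_def orthogonal_matrix_mul det_mul det_transpose)
  have "transpose R2 *v vector [0, 0, -1] = v"
    using R2 by (simp flip: v add: matrix_vector_mul_assoc del: transpose_matrix_vector)
  then have "G *v vector [0, 0, -1] = vector [0, 0, -1]"
    using u \<open>S *v v = u\<close> by (simp add: G_def flip: matrix_vector_mul_assoc del: transpose_matrix_vector)
  moreover have "vector [0, 0, -1] = (- 1) *\<^sub>R (axis 3 1 :: real^3)"
    by (simp add: vec_eq_iff forall_3 axis_def)
  ultimately have "(- 1) *\<^sub>R (G *v axis 3 1) = (- 1) *\<^sub>R (axis 3 1 :: real^3)"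
    by (simp only: matrix_vector_mult_scaleR)
  then have "G *v axis 3 1 = axis 3 1"
    by simp
  moreover have "G ** R2 = R1 ** S"
    using R2 by (simp add: G_def flip: matrix_mul_assoc)
  ultimately show thesis
    using rotation_fixing_axis3[OF \<open>G \<in> SO\<close>] rot_density_tomo_proj that by metis
qed

lemma wasserstein_tomo_proj_le:
  fixes A B :: "real^3^3" and \<rho> :: "real^3 \<Rightarrow> real"
  assumes "orthogonal_matrix A" "orthogonal_matrix B"
    and [measurable]: "\<rho> \<in> borel_measurable borel" and "\<And>x. 0 \<le> \<rho> x"
    and one: "(\<integral>\<^sup>+x. \<rho> x \<partial>lborel) = 1" and supp: "\<And>x. x \<notin> cball 0 1 \<Longrightarrow> \<rho> x = 0"
    and close: "\<And>x. x \<in> cball 0 1 \<Longrightarrow> norm (A *v x - B *v x) \<le> c"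
    and "p > 0" "c \<ge> 0"
  shows "wasserstein p (dens_measure (tomo_proj A \<rho>)) (dens_measure (tomo_proj B \<rho>)) \<le> c"
proof -
  have "prob_space (density lborel \<rho>)"
    by (rule prob_spaceI) (simp add: emeasure_density one)
  moreover have "dist (proj12 (A *v x)) (proj12 (B *v x)) \<le> c" if "0 < \<rho> x" for x
  proof -
    have "x \<in> cball 0 1" using supp that by force
    then show ?thesis
      using close[of x] dist_proj12_le[of "A *v x" "B *v x"] by (simp add: dist_norm)
  qed
  then have "AE x in density lborel \<rho>. dist (proj12 (A *v x)) (proj12 (B *v x)) \<le> c"
    by (subst AE_density) auto
  ultimately show ?thesis
    using assms by (simp add: dens_measure_tomo_proj wasserstein_distr_le)
qed

lemma wasserstein_rot_le:
  assumes "g \<in> SO"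
  shows "wasserstein_rot p I1 I2 \<le> wasserstein p (dens_measure I1) (dens_measure (rot_density g I2))"
  unfolding wasserstein_rot_def
  by (rule cINF_lower[OF _ assms]) (auto intro: bdd_belowI[where m = 0] simp: wasserstein_def)

lemma wasserstein_rot_nonneg: "0 \<le> wasserstein_rot p I1 I2"
proof -
  have "mat 1 \<in> (SO :: (real^2^2) set)"
    by (simp add: SO_def orthogonal_matrix_id)
  then show ?thesis
    unfolding wasserstein_rot_def by (intro cINF_greatest) (auto simp: wasserstein_def)
qed

lemma wasserstein_rot_tomo_proj_le:
  fixes \<rho> :: "real^3 \<Rightarrow> real" and u v :: "real^3" and R1 R2 :: "real^3^3"
  assumes "p > 0"
    and "\<rho> \<in> borel_measurable borel" "\<And>x. 0 \<le> \<rho> x" "(\<integral>\<^sup>+x. \<rho> x \<partial>lborel) = 1"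
    and "\<And>x. x \<notin> cball 0 1 \<Longrightarrow> \<rho> x = 0"
    and u: "norm u = 1" and v: "norm v = 1"
    and "R1 \<in> SO" "R1 *v u = vector [0, 0, -1]" "R2 \<in> SO" "R2 *v v = vector [0, 0, -1]"
  shows "wasserstein_rot p (tomo_proj R1 \<rho>) (tomo_proj R2 \<rho>) \<le> norm (u - v)"
proof -
  obtain S where "S \<in> SO" "S *v v = u" and S_close: "\<And>x. norm (x - S *v x) \<le> norm (u - v) * norm x"
    using rotation_onto_unit_vector[OF u v] by blast
  then obtain g where "g \<in> SO" and g: "rot_density g (tomo_proj R2 \<rho>) = tomo_proj (R1 ** S) \<rho>"
    using tomo_proj_in_plane_rotation assms(8-11) by blast
  have R1: "orthogonal_matrix R1" and R1S: "orthogonal_matrix (R1 ** S)"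
    using \<open>R1 \<in> SO\<close> \<open>S \<in> SO\<close> by (simp_all add: SO_def orthogonal_matrix_mul)
  have close: "norm (R1 *v x - (R1 ** S) *v x) \<le> norm (u - v)" if "x \<in> cball 0 1" for x
  proof -
    have "norm (R1 *v x - (R1 ** S) *v x) = norm (R1 *v (x - S *v x))"
      by (simp add: matrix_vector_mult_diff_distrib flip: matrix_vector_mul_assoc)
    also have "\<dots> = norm (x - S *v x)"
      using R1 by (rule norm_orthogonal_matrix_mult)
    also have "\<dots> \<le> norm (u - v) * norm x"
      by (rule S_close)
    also have "\<dots> \<le> norm (u - v)"
      using that by (simp add: mult_left_le)
    finally show ?thesis .
  qed
  have "wasserstein_rot p (tomo_proj R1 \<rho>) (tomo_proj R2 \<rho>)
      \<le> wasserstein p (dens_measure (tomo_proj R1 \<rho>)) (dens_measure (tomo_proj (R1 ** S) \<rho>))"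
    using wasserstein_rot_le[OF \<open>g \<in> SO\<close>, of p "tomo_proj R1 \<rho>" "tomo_proj R2 \<rho>"] by (simp only: g)
  also have "\<dots> \<le> norm (u - v)"
    using assms(1-5) by (intro wasserstein_tomo_proj_le[OF R1 R1S] close) auto
  finally show ?thesis .
qed

theorem proposition1:
  fixes p :: real and \<rho> :: "real^3 \<Rightarrow> real" and u v :: "real^3"
    and R1 R2 :: "real^3^3"
  assumes "p \<ge> 1"
    and "\<rho> \<in> borel_measurable lborel"
    and "\<forall>x. \<rho> x \<ge> 0"
    and "(\<integral>\<^sup>+ x. ennreal (\<rho> x) \<partial>lborel) = 1"
    and "\<forall>x. x \<notin> cball 0 1 \<longrightarrow> \<rho> x = 0"
    and "norm u = 1" and "norm v = 1"
    and "R1 \<in> SO" and "R1 *v u = vector [0, 0, -1]"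
    and "R2 \<in> SO" and "R2 *v v = vector [0, 0, -1]"
  shows "wasserstein_rot p (tomo_proj R1 \<rho>) (tomo_proj R2 \<rho>) powr p
           \<le> (2 * sin (vec_angle u v / 2)) powr p
         \<and> (2 * sin (vec_angle u v / 2)) powr p \<le> vec_angle u v powr p"
proof -
  have chord: "norm (u - v) = 2 * sin (vec_angle u v / 2)"
    using assms(6,7) by (rule norm_diff_eq_chord)
  have "wasserstein_rot p (tomo_proj R1 \<rho>) (tomo_proj R2 \<rho>) \<le> 2 * sin (vec_angle u v / 2)"
    using assms unfolding chord[symmetric] by (intro wasserstein_rot_tomo_proj_le) auto
  moreover have "2 * sin (vec_angle u v / 2) \<le> vec_angle u v"
    using sin_x_le_x[of "vec_angle u v / 2"] vec_angle_unit_bounds[OF assms(6,7)] by simp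
  moreover have "0 \<le> 2 * sin (vec_angle u v / 2)"
    unfolding chord[symmetric] by simp
  ultimately show ?thesis
    using wasserstein_rot_nonneg \<open>p \<ge> 1\<close> by (auto intro: powr_mono2)
qed

end
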